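(* Let $F$ be a field of characteristic $\neq 2$ and let $A$ be an associative $F$-algebra (not necessarily unital) generated, as an $F$-algebra, by a finite collection of nilpotent elements. Then for every integer $i\geq 1$ the derived power $A^{[i]}$ is a finitely generated Lie algebra over $F$.
   Context: Associative algebras are not assumed to have a unit, and "generated" means generated as a not necessarily unital algebra (every element is a linear combination of nonempty products of generators). For an associative algebra $A$, $A^{(-)}$ denotes the Lie algebra on the vector space $A$ with bracket $[a,b]=ab-ba$. For subspaces $X,Y\subseteq A$, $[X,Y]$ denotes the linear span of all $[x,y]$, $x\in X$, $y\in Y$. The derived series of $A^{(-)}$ is defined by $A^{[0]}=A^{(-)}$ and $A^{[i+1]}=[A^{[i]},A^{[i]}]$ for $i\ge 0$; each $A^{[i]}$ is a Lie subalgebra of $A^{(-)}$. An element $a\in A$ is nilpotent if there is an integer $n(a)\geq 1$ with $a^{n(a)}=0$. *)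

theory Defs
  imports Complex_Main
begin

text \<open>
  The class \<^class>\<open>ring\<close> does not require a unit, so powers with positive exponent
  have to be iterated products. The exponent 0 is a junk case (it gives \<open>a\<close>).
\<close>

definition ring_power :: "'a::ring \<Rightarrow> nat \<Rightarrow> 'a"
  where "ring_power a n = (((*) a) ^^ (n - 1)) a"

definition nilpotent_element :: "'a::ring \<Rightarrow> bool"
  where "nilpotent_element a \<longleftrightarrow> (\<exists>n\<ge>1. ring_power a n = 0)"

definition nonempty_products :: "'a::ring set \<Rightarrow> 'a set"
  where "nonempty_products S = {foldl (*) x xs | x xs. x \<in> S \<and> set xs \<subseteq> S}"

definition lie_bracket :: "'a::ring \<Rightarrow> 'a \<Rightarrow> 'a"
  where "lie_bracket a b = a * b - b * a"

locale assoc_algebra = vector_space scale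
  for scale :: "'f::field \<Rightarrow> 'a::ring \<Rightarrow> 'a"  (infixr \<open>*s\<close> 75) +
  assumes scale_mult_left: "(c *s x) * y = c *s (x * y)"
    and scale_mult_right: "x * (c *s y) = c *s (x * y)"
begin

definition algebra_generated_by :: "'a set \<Rightarrow> bool"
  where "algebra_generated_by S \<longleftrightarrow> span (nonempty_products S) = UNIV"

definition bracket_space :: "'a set \<Rightarrow> 'a set \<Rightarrow> 'a set"
  where "bracket_space X Y = span {lie_bracket x y | x y. x \<in> X \<and> y \<in> Y}"

primrec derived_power :: "nat \<Rightarrow> 'a set"
  where
    "derived_power 0 = UNIV"
  | "derived_power (Suc i) = bracket_space (derived_power i) (derived_power i)"

definition lie_subalgebra :: "'a set \<Rightarrow> bool"
  where "lie_subalgebra L \<longleftrightarrow> subspace L \<and> (\<forall>x\<in>L. \<forall>y\<in>L. lie_bracket x y \<in> L)"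

definition finitely_generated_lie :: "'a set \<Rightarrow> bool"
  where "finitely_generated_lie L \<longleftrightarrow>
    lie_subalgebra L \<and> (\<exists>S. finite S \<and> S \<subseteq> L \<and> lie_subalgebra hull S = L)"

lemma derived_power_Suc_subset: "derived_power (Suc i) \<subseteq> derived_power i"
proof (induction i)
  case 0
  show ?case by simp
next
  case (Suc i)
  have "bracket_space X X \<subseteq> bracket_space Y Y" if "X \<subseteq> Y" for X Y
    unfolding bracket_space_def by (rule span_mono) (use that in blast)
  from this[OF Suc] show ?case by simp
qed

lemma lie_subalgebra_derived_power: "lie_subalgebra (derived_power i)"
proof (cases i)
  case 0
  then show ?thesis by (simp add: lie_subalgebra_def)
next
  case (Suc j)
  have "lie_bracket x y \<in> derived_power i"
    if "x \<in> derived_power i" "y \<in> derived_power i" for x y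
  proof -
    have "lie_bracket x y \<in> derived_power (Suc i)"
      using that by (auto simp: bracket_space_def intro!: span_base)
    then show ?thesis using derived_power_Suc_subset by blast
  qed
  then show ?thesis
    using Suc by (auto simp: lie_subalgebra_def bracket_space_def)
qed

end

end

theory Submission
  imports Defs
begin

text \<open>
  Grade everything by word length in the generators. Every graded ideal \<open>P\<close> containing a graded
  derived power contains all long words: otherwise some such \<open>P\<close> is maximal among the graded ideals
  not containing all words of some length (these words are finite in number, so Zorn's lemma
  applies), and it is prime. In a prime algebra of characteristic \<open>\<noteq> 2\<close> a Lie ideal \<open>U\<close> with
  \<open>[U, U]\<close> central is itself central, so descending along the derived series shows that the
  algebra is commutative modulo \<open>P\<close>; nilpotent generators then lie in \<open>P\<close>, a contradiction.

  By a theorem of Herstein the ideal \<open>I\<close> generated by \<open>A\<^sup>[\<^sup>i\<^sup>+\<^sup>1\<^sup>]\<close> satisfies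
  \<open>[I, A] \<subseteq> A\<^sup>[\<^sup>i\<^sup>]\<close>. As \<open>I\<close> contains all long words and \<open>[A, A]\<close> is spanned by brackets with
  a generator, \<open>A\<^sup>[\<^sup>1\<^sup>]\<close> and \<open>A\<^sup>[\<^sup>i\<^sup>]\<close> agree in all large degrees. Hence in large degrees
  \<open>A\<^sup>[\<^sup>i\<^sup>] = [A\<^sup>[\<^sup>i\<^sup>], A\<^sup>[\<^sup>i\<^sup>]]\<close>, and the finitely many small degrees generate \<open>A\<^sup>[\<^sup>i\<^sup>]\<close>.
\<close>

section \<open>Linear algebra of products and brackets\<close>

context assoc_algebra
begin

lemma subspace_mult_left: "subspace V \<Longrightarrow> subspace {x. x * y \<in> V}"
  by (auto simp: subspace_def distrib_right scale_mult_left)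

lemma subspace_mult_right: "subspace V \<Longrightarrow> subspace {y. x * y \<in> V}"
  by (auto simp: subspace_def distrib_left scale_mult_right)

lemma lie_bracket_add_left: "lie_bracket (x + x') y = lie_bracket x y + lie_bracket x' y"
  and lie_bracket_add_right: "lie_bracket x (y + y') = lie_bracket x y + lie_bracket x y'"
  by (auto simp: lie_bracket_def algebra_simps)

lemma lie_bracket_scale_left: "lie_bracket (c *s x) y = c *s lie_bracket x y"
  and lie_bracket_scale_right: "lie_bracket x (c *s y) = c *s lie_bracket x y"
  by (auto simp: lie_bracket_def scale_mult_left scale_mult_right scale_right_diff_distrib)

lemma lie_bracket_0 [simp]: "lie_bracket 0 y = 0" "lie_bracket x 0 = 0"
  by (auto simp: lie_bracket_def)

lemma subspace_bracket_left: "subspace V \<Longrightarrow> subspace {x. lie_bracket x y \<in> V}"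
  by (auto simp: subspace_def lie_bracket_add_left lie_bracket_scale_left)

lemma subspace_bracket_right: "subspace V \<Longrightarrow> subspace {y. lie_bracket x y \<in> V}"
  by (auto simp: subspace_def lie_bracket_add_right lie_bracket_scale_right)

lemma span_induct_subspace:
  assumes "x \<in> span X" "subspace {x. Q x}" "\<And>x. x \<in> X \<Longrightarrow> Q x"
  shows "Q x"
  using span_minimal[of X "{x. Q x}"] assms by blast

lemma mult_span_mem:
  assumes "x \<in> span X" "y \<in> span Y" "subspace V"
    and "\<And>x y. x \<in> X \<Longrightarrow> y \<in> Y \<Longrightarrow> x * y \<in> V"
  shows "x * y \<in> V"
proof -
  have "x * y \<in> V" if "x \<in> X" for x
    by (rule span_induct_subspace[OF assms(2)]) (use assms that subspace_mult_right in auto)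
  then show ?thesis
    by (rule span_induct_subspace[OF assms(1) subspace_mult_left[OF assms(3)]])
qed

lemma bracket_span_mem:
  assumes "x \<in> span X" "y \<in> span Y" "subspace V"
    and "\<And>x y. x \<in> X \<Longrightarrow> y \<in> Y \<Longrightarrow> lie_bracket x y \<in> V"
  shows "lie_bracket x y \<in> V"
proof -
  have "lie_bracket x y \<in> V" if "x \<in> X" for x
    by (rule span_induct_subspace[OF assms(2)]) (use assms that subspace_bracket_right in auto)
  then show ?thesis
    by (rule span_induct_subspace[OF assms(1) subspace_bracket_left[OF assms(3)]])
qed

text \<open>An independent set inside the span of a finite set is finite, so a basis of
  \<open>V\<close> will do.\<close>

lemma subspace_finite_generating_set:
  assumes "finite W" "subspace V" "V \<subseteq> span W"
  obtains E where "finite E" "E \<subseteq> V" "V \<subseteq> span E"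
proof -
  obtain E where "E \<subseteq> V" "independent E" "V \<subseteq> span E"
    using maximal_independent_subset by blast
  then show thesis
    using that independent_span_bound[OF assms(1), of E] assms(3) by blast
qed

text \<open>Division by 2 inside a subspace; this is the one point where characteristic \<noteq> 2
  is put to use.\<close>

lemma two_cancel_subspace:
  assumes "(2::'f) \<noteq> 0" "subspace V" "x + x \<in> V"
  shows "x \<in> V"
proof -
  have "(2::'f) *s x = x + x"
    using scale_left_distrib[of 1 1 x] by simp
  then have "x = inverse (2::'f) *s (x + x)"
    using assms(1) by (metis scale_scale left_inverse scale_one)
  then show ?thesis using subspace_scale[OF assms(2,3)] by metis
qed

end

locale fg_algebra = assoc_algebra scale
  for scale :: "'f::field \<Rightarrow> 'a::ring \<Rightarrow> 'a"  (infixr \<open>*s\<close> 75) +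
  fixes G :: "'a set"
  assumes finite_G: "finite G"
begin

subsection \<open>Grading by word length\<close>

text \<open>Without a unit there is no empty word, so length 0 is empty and words start at length 1.
  Letters are appended on the right, matching the left-nested products of
  \<open>nonempty_products\<close>.\<close>

fun words :: "nat \<Rightarrow> 'a set" where
  "words 0 = {}"
| "words (Suc 0) = G"
| "words (Suc (Suc n)) = {x * g | x g. x \<in> words (Suc n) \<and> g \<in> G}"

definition wspan :: "nat \<Rightarrow> 'a set"
  where "wspan d = span (words d)"

lemma wspan_0 [simp]: "wspan 0 = {0}"
  by (simp add: wspan_def)

lemma subspace_wspan [simp, intro]: "subspace (wspan d)"
  by (simp add: wspan_def)

lemma words_wspan: "x \<in> words d \<Longrightarrow> x \<in> wspan d"
  by (simp add: wspan_def span_base)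

lemma finite_words: "finite (words d)"
proof (induction d rule: words.induct)
  case (3 n)
  have "words (Suc (Suc n)) = (\<lambda>(x, g). x * g) ` (words (Suc n) \<times> G)" by auto
  then show ?case using 3 finite_G by (metis finite_SigmaI finite_imageI)
qed (use finite_G in auto)

lemma words_Suc: "x \<in> words d \<Longrightarrow> g \<in> G \<Longrightarrow> x * g \<in> words (Suc d)"
  by (cases d) auto

lemma words_mult: "x \<in> words d \<Longrightarrow> y \<in> words e \<Longrightarrow> x * y \<in> words (d + e)"
proof (induction e arbitrary: y rule: words.induct)
  case 2
  then show ?case by (simp add: words_Suc)
next
  case (3 n)
  then obtain y' g where y: "y = y' * g" "y' \<in> words (Suc n)" "g \<in> G" by auto
  then have "x * y' * g \<in> words (Suc (d + Suc n))" using 3 by (intro words_Suc) auto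
  then show ?case by (simp add: y mult.assoc)
qed auto

lemma words_split: "x \<in> words (d + e) \<Longrightarrow> d > 0 \<Longrightarrow> e > 0 \<Longrightarrow> \<exists>u\<in>words d. \<exists>v\<in>words e. x = u * v"
proof (induction e arbitrary: x rule: words.induct)
  case 2
  then show ?case by (cases d) auto
next
  case (3 n)
  then obtain x' g where x: "x = x' * g" "x' \<in> words (d + Suc n)" "g \<in> G" by auto
  then obtain u v where "u \<in> words d" "v \<in> words (Suc n)" "x' = u * v" using 3 by blast
  then show ?case using x by (auto simp: mult.assoc)
qed auto

lemma wspan_mult: "x \<in> wspan d \<Longrightarrow> y \<in> wspan e \<Longrightarrow> x * y \<in> wspan (d + e)"
  by (rule mult_span_mem[of _ "words d" _ "words e"])
    (auto simp: words_mult words_wspan wspan_def[of d] wspan_def[of e])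

lemma wspan_lie_bracket: "x \<in> wspan d \<Longrightarrow> y \<in> wspan e \<Longrightarrow> lie_bracket x y \<in> wspan (d + e)"
  using wspan_mult[of x d y e] wspan_mult[of y e x d]
  by (simp add: lie_bracket_def subspace_diff add.commute)

text \<open>
  The algebra itself need not be graded: the spaces of distinct degrees may overlap. Indexing by
  word length replaces the passage to the free algebra modulo the relations \<open>g\<^sup>n = 0\<close>, where the
  grading would be an actual one.
\<close>

primrec graded_derived :: "nat \<Rightarrow> nat \<Rightarrow> 'a set" where
  "graded_derived 0 d = wspan d"
| "graded_derived (Suc i) d = span {lie_bracket x y | x y e f. e + f = d \<and> x \<in> graded_derived i e \<and> y \<in> graded_derived i f}"

lemma subspace_graded_derived [simp, intro]: "subspace (graded_derived i d)"
  by (cases i) auto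

lemma graded_derived_Suc_bracket: "x \<in> graded_derived i d \<Longrightarrow> y \<in> graded_derived i e \<Longrightarrow> lie_bracket x y \<in> graded_derived (Suc i) (d + e)"
  by (auto intro!: span_base)

lemma graded_derived_induct:
  assumes "x \<in> graded_derived (Suc i) d" "subspace {x. Q x}"
    and "\<And>u v e f. d = e + f \<Longrightarrow> u \<in> graded_derived i e \<Longrightarrow> v \<in> graded_derived i f \<Longrightarrow> Q (lie_bracket u v)"
  shows "Q x"
  by (rule span_induct_subspace[OF assms(1)[simplified] assms(2)]) (use assms(3) in auto)

text \<open>By the Jacobi identity \<open>[[u, v], y] = [[u, y], v] + [u, [v, y]]\<close>, and by
  induction the inner brackets stay in the previous stage.\<close>

lemma graded_derived_lie_ideal: "x \<in> graded_derived i d \<Longrightarrow> y \<in> wspan e \<Longrightarrow> lie_bracket x y \<in> graded_derived i (d + e)"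
proof (induction i arbitrary: x d y e)
  case 0
  then show ?case by (simp add: wspan_lie_bracket)
next
  case (Suc i)
  from Suc.prems(1) show ?case
  proof (rule graded_derived_induct)
    show "subspace {x. lie_bracket x y \<in> graded_derived (Suc i) (d + e)}"
      by (rule subspace_bracket_left) (rule subspace_graded_derived)
    fix u v d1 d2 assume d: "d = d1 + d2" and u: "u \<in> graded_derived i d1" and v: "v \<in> graded_derived i d2"
    have eq: "lie_bracket (lie_bracket u v) y = lie_bracket (lie_bracket u y) v + lie_bracket u (lie_bracket v y)"
      by (simp add: lie_bracket_def algebra_simps)
    have "lie_bracket (lie_bracket u y) v \<in> graded_derived (Suc i) (d1 + e + d2)"
      "lie_bracket u (lie_bracket v y) \<in> graded_derived (Suc i) (d1 + (d2 + e))"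
      using u v Suc by (meson graded_derived_Suc_bracket)+
    then show "lie_bracket (lie_bracket u v) y \<in> graded_derived (Suc i) (d + e)"
      unfolding eq d by (intro subspace_add) (auto simp: add_ac simp del: graded_derived.simps)
  qed
qed

lemma graded_derived_Suc_subset_aux: "(\<forall>d. graded_derived i d \<subseteq> wspan d) \<and> (\<forall>d. graded_derived (Suc i) d \<subseteq> graded_derived i d)"
proof (induction i)
  case 0
  then show ?case
    by (auto simp del: graded_derived.simps(2) elim!: graded_derived_induct simp: wspan_lie_bracket)
next
  case (Suc i)
  show ?case
  proof (intro conjI allI subsetI)
    fix d x assume "x \<in> graded_derived (Suc i) d" then show "x \<in> wspan d" using Suc by blast
  next
    fix d x assume "x \<in> graded_derived (Suc (Suc i)) d"
    then show "x \<in> graded_derived (Suc i) d"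
      by (rule graded_derived_induct) (simp del: graded_derived.simps, use Suc graded_derived_Suc_bracket in blast)
  qed
qed

lemma graded_derived_Suc_subset: "graded_derived (Suc i) d \<subseteq> graded_derived i d"
  and graded_derived_subset_wspan: "graded_derived i d \<subseteq> wspan d"
  using graded_derived_Suc_subset_aux by blast+

lemma graded_derived_Suc_subset_1: "graded_derived (Suc i) d \<subseteq> graded_derived (Suc 0) d"
  by (induction i) (use graded_derived_Suc_subset in blast)+

subsection \<open>Graded prime ideals\<close>

text \<open>A graded ideal is encoded by its components. \<open>P d\<close> may exceed
  \<open>wspan d\<close>, so that annihilators qualify without being intersected with it.\<close>

definition gideal :: "(nat \<Rightarrow> 'a set) \<Rightarrow> bool" where
  "gideal P \<longleftrightarrow> (\<forall>d. subspace (P d)) \<and>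
    (\<forall>d e x y. x \<in> wspan d \<longrightarrow> y \<in> P e \<longrightarrow> x * y \<in> P (d + e) \<and> y * x \<in> P (d + e))"

text \<open>Length 0 is excluded because \<open>wspan 0 = {0}\<close> lies in every ideal.\<close>

definition eventually_full :: "(nat \<Rightarrow> 'a set) \<Rightarrow> bool" where
  "eventually_full P \<longleftrightarrow> (\<exists>n>0. wspan n \<subseteq> P n)"

lemma gidealD:
  assumes "gideal P"
  shows "subspace (P d)"
    and "x \<in> wspan d \<Longrightarrow> y \<in> P e \<Longrightarrow> x * y \<in> P (d + e)"
    and "x \<in> wspan d \<Longrightarrow> y \<in> P e \<Longrightarrow> y * x \<in> P (e + d)"
  using assms unfolding gideal_def by (auto simp: add.commute)

lemma gidealI:
  assumes "\<And>d. subspace (P d)"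
    and "\<And>d e x y. x \<in> wspan d \<Longrightarrow> y \<in> P e \<Longrightarrow> x * y \<in> P (d + e)"
    and "\<And>d e x y. x \<in> wspan d \<Longrightarrow> y \<in> P e \<Longrightarrow> y * x \<in> P (e + d)"
  shows "gideal P"
  using assms unfolding gideal_def by (auto simp: add.commute)

text \<open>A word longer than \<open>n\<close> starts with a word of length \<open>n\<close>, which
  already lies in the ideal.\<close>

lemma wspan_subset_gideal_mono:
  assumes P: "gideal P" and n: "0 < n" "wspan n \<subseteq> P n" and d: "n \<le> d"
  shows "wspan d \<subseteq> P d"
proof (cases "n = d")
  case False
  have "words d \<subseteq> P d"
  proof
    fix x assume "x \<in> words d"
    then obtain u v where "u \<in> words n" "v \<in> words (d - n)" "x = u * v"
      using words_split[of x n "d - n"] n d False by auto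
    then show "x \<in> P d"
      using gidealD(3)[OF P, of v "d - n" u n] n d words_wspan by auto
  qed
  then show ?thesis
    unfolding wspan_def by (rule span_minimal) (rule gidealD(1)[OF P])
qed (use n in simp)

definition maximal_nonfull :: "(nat \<Rightarrow> 'a set) \<Rightarrow> bool" where
  "maximal_nonfull M \<longleftrightarrow> gideal M \<and> \<not> eventually_full M \<and>
    (\<forall>Q. gideal Q \<longrightarrow> (\<forall>d. M d \<subseteq> Q d) \<longrightarrow> \<not> eventually_full Q \<longrightarrow> (\<forall>d. Q d \<subseteq> M d))"

text \<open>If \<open>a\<close> and \<open>b\<close> were both outside \<open>M\<close>, two
  annihilator ideals modulo \<open>M\<close> would properly contain \<open>M\<close>, hence contain
  all words of some lengths \<open>n\<close> and \<open>m\<close>; then \<open>M\<close> would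
  contain all words of length \<open>n + 1 + m\<close>.\<close>

lemma maximal_nonfull_prime:
  assumes M: "maximal_nonfull M"
    and a: "a \<in> wspan d" and b: "b \<in> wspan e"
    and ab: "\<And>c f. c \<in> wspan f \<Longrightarrow> a * c * b \<in> M (d + f + e)"
  shows "a \<in> M d \<or> b \<in> M e"
proof (rule ccontr)
  assume neg: "\<not> ?thesis"
  have gM: "gideal M" and ncM: "\<not> eventually_full M"
    and max: "\<And>Q. gideal Q \<Longrightarrow> (\<And>d. M d \<subseteq> Q d) \<Longrightarrow> \<not> eventually_full Q \<Longrightarrow> \<forall>d. Q d \<subseteq> M d"
    using M unfolding maximal_nonfull_def by blast+
  have sub: "subspace (M k)" for k using gidealD(1)[OF gM] .
  \<comment> \<open>The left annihilator of all \<open>c * b\<close> modulo \<open>M\<close>. It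
    contains \<open>M\<close>, and \<open>a\<close> by hypothesis, so maximality makes it eventually
    full.\<close>
  define Q where "Q k = {x. \<forall>f c. c \<in> wspan f \<longrightarrow> x * c * b \<in> M (k + f + e)}" for k
  have gQ: "gideal Q"
  proof (rule gidealI)
    show "subspace (Q k)" for k
      unfolding Q_def using sub
      by (auto simp: subspace_def distrib_right scale_mult_left)
    fix k l x y assume x: "x \<in> wspan k" and y: "y \<in> Q l"
    show "x * y \<in> Q (k + l)"
      unfolding Q_def
    proof (intro CollectI allI impI)
      fix f c assume "c \<in> wspan f"
      then have "x * (y * c * b) \<in> M (k + (l + f + e))"
        using y x gidealD(2)[OF gM] unfolding Q_def by blast
      then show "x * y * c * b \<in> M (k + l + f + e)"
        by (simp add: mult.assoc add.assoc)
    qed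
    show "y * x \<in> Q (l + k)"
      unfolding Q_def
    proof (intro CollectI allI impI)
      fix f c assume "c \<in> wspan f"
      then have "y * (x * c) * b \<in> M (l + (k + f) + e)"
        using y x wspan_mult unfolding Q_def by blast
      then show "y * x * c * b \<in> M (l + k + f + e)"
        by (simp add: mult.assoc add.assoc)
    qed
  qed
  have MQ: "M k \<subseteq> Q k" for k
    unfolding Q_def using gidealD(3)[OF gM] b by blast
  have "a \<in> Q d" unfolding Q_def using ab by blast
  then have "eventually_full Q" using max[OF gQ MQ] neg by blast
  then obtain n where n: "n > 0" "wspan n \<subseteq> Q n" unfolding eventually_full_def by blast
  \<comment> \<open>The right annihilator of all \<open>x * c\<close> with \<open>x\<close> in
    \<open>Q\<close>; it contains \<open>b\<close>. Restricting \<open>x\<close> to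
    \<open>wspan k\<close> allows \<open>x * c\<close> to multiply \<open>M\<close>, which gives
    \<open>M k \<subseteq> R k\<close>.\<close>
  define R where "R l = {y. \<forall>k x f c. x \<in> wspan k \<inter> Q k \<longrightarrow> c \<in> wspan f \<longrightarrow> x * c * y \<in> M (k + f + l)}" for l
  have gR: "gideal R"
  proof (rule gidealI)
    show "subspace (R k)" for k
      unfolding R_def using sub
      by (auto simp: subspace_def distrib_left scale_mult_right)
    fix k l x y assume x: "x \<in> wspan k" and y: "y \<in> R l"
    show "x * y \<in> R (k + l)"
      unfolding R_def
    proof (intro CollectI allI impI)
      fix j z f c assume "z \<in> wspan j \<inter> Q j" "c \<in> wspan f"
      then have "z * (c * x) * y \<in> M (j + (f + k) + l)"
        using y x wspan_mult unfolding R_def by blast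
      then show "z * c * (x * y) \<in> M (j + f + (k + l))"
        by (simp add: mult.assoc add.assoc)
    qed
    show "y * x \<in> R (l + k)"
      unfolding R_def
    proof (intro CollectI allI impI)
      fix j z f c assume "z \<in> wspan j \<inter> Q j" "c \<in> wspan f"
      then have "z * c * y * x \<in> M (j + f + l + k)"
        using y x gidealD(3)[OF gM] unfolding R_def by blast
      then show "z * c * (y * x) \<in> M (j + f + (l + k))"
        by (simp add: mult.assoc add.assoc)
    qed
  qed
  have MR: "M k \<subseteq> R k" for k
    unfolding R_def using gidealD(2)[OF gM] wspan_mult by blast
  have "b \<in> R e" unfolding R_def Q_def by blast
  then have "eventually_full R" using max[OF gR MR] neg by blast
  then obtain m where m: "m > 0" "wspan m \<subseteq> R m" unfolding eventually_full_def by blast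
  \<comment> \<open>The extra letter supplies the middle factor \<open>c\<close>, as there is no
    unit to take its place.\<close>
  have "words (n + 1 + m) \<subseteq> M (n + 1 + m)"
  proof
    fix x assume "x \<in> words (n + 1 + m)"
    then obtain u v where uv: "u \<in> words (n + 1)" "v \<in> words m" "x = u * v"
      using words_split[of x "n + 1" m] m by auto
    then obtain p c where pc: "p \<in> words n" "c \<in> words 1" "u = p * c"
      using words_split[of u n 1] n by auto
    have "p \<in> wspan n \<inter> Q n" "c \<in> wspan 1" "v \<in> R m"
      using uv pc n m words_wspan by blast+
    then show "x \<in> M (n + 1 + m)" using uv pc unfolding R_def by blast
  qed
  then have "wspan (n + 1 + m) \<subseteq> M (n + 1 + m)"
    unfolding wspan_def by (rule span_minimal) (rule sub)
  then show False using ncM n unfolding eventually_full_def by (metis add_gr_0)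
qed

text \<open>The union of a chain stays nonfull: otherwise the finitely many words of some length
  \<open>n\<close> would already lie in a single member of the chain.\<close>

lemma ex_maximal_nonfull:
  assumes P: "gideal P" "\<not> eventually_full P"
  obtains M where "maximal_nonfull M" "\<And>d. P d \<subseteq> M d"
proof -
  \<comment> \<open>Families become relations, so that componentwise inclusion turns into inclusion
    of sets; \<open>F\<close> recovers the family.\<close>
  define F where "F Q = (\<lambda>d::nat. Q `` {d})" for Q :: "(nat \<times> 'a) set"
  define Z where "Z = {Q. gideal (F Q) \<and> \<not> eventually_full (F Q) \<and> Sigma UNIV P \<subseteq> Q}"
  have FS: "F (Sigma UNIV Q) = Q" for Q unfolding F_def by auto
  have "Sigma UNIV P \<in> Z" unfolding Z_def using P FS by auto
  then have "Z \<noteq> {}" by blast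
  moreover have "\<Union>K \<in> Z" if K: "K \<noteq> {}" "subset.chain Z K" for K
  proof -
    have KZ: "K \<subseteq> Z" using K(2) by (simp add: subset_chain_def)
    have dir: "\<exists>Q\<in>K. Q1 \<subseteq> Q \<and> Q2 \<subseteq> Q" if "Q1 \<in> K" "Q2 \<in> K" for Q1 Q2
    proof -
      have "Q1 \<subseteq> Q2 \<or> Q2 \<subseteq> Q1" using that K(2) by (simp add: subset_chain_def)
      then show ?thesis using that by (metis order_refl)
    qed
    have mem: "x \<in> F (\<Union>K) d \<longleftrightarrow> (\<exists>Q\<in>K. x \<in> F Q d)" for x d
      unfolding F_def by auto
    have mono: "F Q1 d \<subseteq> F Q2 d" if "Q1 \<subseteq> Q2" for Q1 Q2 d
      using that unfolding F_def by auto
    have gQ: "gideal (F Q)" "\<not> eventually_full (F Q)" if "Q \<in> K" for Q using that KZ unfolding Z_def by auto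
    have "gideal (F (\<Union>K))"
    proof (rule gidealI)
      fix d show "subspace (F (\<Union>K) d)"
      proof (rule subspaceI)
        show "0 \<in> F (\<Union>K) d" unfolding mem using K(1) gQ(1) gidealD(1) subspace_0 by blast
        fix x y assume "x \<in> F (\<Union>K) d" "y \<in> F (\<Union>K) d"
        then obtain Q1 Q2 where "Q1 \<in> K" "Q2 \<in> K" "x \<in> F Q1 d" "y \<in> F Q2 d" unfolding mem by blast
        then obtain Q where "Q \<in> K" "x \<in> F Q d" "y \<in> F Q d" using dir mono by (meson subsetD)
        then show "x + y \<in> F (\<Union>K) d" unfolding mem using gQ(1) gidealD(1) subspace_add by blast
      next
        fix c x assume "x \<in> F (\<Union>K) d"
        then show "c *s x \<in> F (\<Union>K) d" unfolding mem using gQ(1) gidealD(1) subspace_scale by blast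
      qed
    next
      fix d e x y assume "x \<in> wspan d" "y \<in> F (\<Union>K) e"
      then show "x * y \<in> F (\<Union>K) (d + e)" "y * x \<in> F (\<Union>K) (e + d)"
        unfolding mem using gQ(1) gidealD(2,3) by blast+
    qed
    moreover have "\<not> eventually_full (F (\<Union>K))"
    proof
      assume "eventually_full (F (\<Union>K))"
      then obtain n where n: "n > 0" "wspan n \<subseteq> F (\<Union>K) n" unfolding eventually_full_def by blast
      have "\<exists>Q\<in>K. X \<subseteq> F Q n" if "finite X" "X \<subseteq> F (\<Union>K) n" for X
        using that
      proof (induction X)
        case empty then show ?case using K(1) by blast
      next
        case (insert x X)
        then obtain Q2 where "Q2 \<in> K" "X \<subseteq> F Q2 n" by blast
        moreover obtain Q1 where "Q1 \<in> K" "x \<in> F Q1 n" using insert.prems mem[of x n] by blast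
        ultimately show ?case using dir[of Q1 Q2] mono[of Q1 _ n] mono[of Q2 _ n] by blast
      qed
      from this[OF finite_words[of n]] obtain Q where Q: "Q \<in> K" "words n \<subseteq> F Q n"
        using n words_wspan by blast
      then have "wspan n \<subseteq> F Q n"
        unfolding wspan_def by (intro span_minimal gidealD(1) gQ)
      then show False using gQ(2) Q n unfolding eventually_full_def by blast
    qed
    moreover have "Sigma UNIV P \<subseteq> \<Union>K" using K(1) KZ unfolding Z_def by blast
    ultimately show ?thesis unfolding Z_def by blast
  qed
  ultimately obtain m where m: "m \<in> Z" and max: "\<And>X. X \<in> Z \<Longrightarrow> m \<subseteq> X \<Longrightarrow> X = m"
    using subset_Zorn_nonempty[of Z] by metis
  have Pm: "P d \<subseteq> F m d" for d using m unfolding Z_def F_def by auto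
  have "maximal_nonfull (F m)"
    unfolding maximal_nonfull_def
  proof (intro conjI allI impI)
    show "gideal (F m)" "\<not> eventually_full (F m)" using m unfolding Z_def by auto
    fix Q d assume Q: "gideal Q" "\<forall>d. F m d \<subseteq> Q d" "\<not> eventually_full Q"
    have "m \<subseteq> Sigma UNIV Q" using Q(2) unfolding F_def by auto
    moreover have "Sigma UNIV P \<subseteq> Sigma UNIV Q" using Pm Q(2) by blast
    ultimately have "Sigma UNIV Q = m" using max Q FS unfolding Z_def by simp
    then show "Q d \<subseteq> F m d" using FS[of Q] by simp
  qed
  then show thesis using that Pm by blast
qed

section \<open>Centrality modulo a graded prime\<close>

definition central_mod :: "(nat \<Rightarrow> 'a set) \<Rightarrow> nat \<Rightarrow> 'a \<Rightarrow> bool" where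
  "central_mod M d z \<longleftrightarrow> (\<forall>e. \<forall>y\<in>wspan e. lie_bracket z y \<in> M (d + e))"

text \<open>A nonzero central element of a prime ring is no zero divisor:
  \<open>z * c * x = [z, c] * x + c * (z * x)\<close> lies in \<open>M\<close> for every
  \<open>c\<close>, and primeness applies.\<close>

lemma central_mod_regular:
  assumes M: "maximal_nonfull M" and z: "z \<in> wspan d" "central_mod M d z"
    and x: "x \<in> wspan e" and zx: "z * x \<in> M (d + e)"
  shows "z \<in> M d \<or> x \<in> M e"
proof (rule maximal_nonfull_prime[OF M z(1) x])
  have gM: "gideal M" using M unfolding maximal_nonfull_def by blast
  fix c f assume c: "c \<in> wspan f"
  have "lie_bracket z c * x \<in> M (d + f + e)"
    using gidealD(3)[OF gM x] z(2) c unfolding central_mod_def by blast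
  moreover have "c * (z * x) \<in> M (f + (d + e))"
    using gidealD(2)[OF gM c zx] .
  moreover have "z * c * x = lie_bracket z c * x + c * (z * x)"
    by (simp add: lie_bracket_def algebra_simps)
  ultimately show "z * c * x \<in> M (d + f + e)"
    using subspace_add[OF gidealD(1)[OF gM]] by (simp add: add_ac)
qed

text \<open>
  For a noncentral \<open>u\<close>, the derivation \<open>D = [u, _]\<close> has central \<open>D\<^sup>2\<close>, and \<open>D\<^sup>2 (u a) = u D\<^sup>2 a\<close> being
  central too forces \<open>D\<^sup>2 = 0\<close>. Then \<open>0 = D\<^sup>2 (a b) = 2 D a D b\<close>, and primeness gives \<open>D = 0\<close>.
\<close>

lemma lie_ideal_central_step:
  assumes two: "(2::'f) \<noteq> 0" and M: "maximal_nonfull M"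
    and cen: "\<And>d x. x \<in> graded_derived (Suc i) d \<Longrightarrow> central_mod M d x"
    and u: "u \<in> graded_derived i d"
  shows "central_mod M d u"
proof (rule ccontr)
  assume "\<not> central_mod M d u"
  then obtain e0 b0 where b0: "b0 \<in> wspan e0" "lie_bracket u b0 \<notin> M (d + e0)"
    unfolding central_mod_def by blast
  have gM: "gideal M" using M unfolding maximal_nonfull_def by blast
  have sub: "subspace (M k)" for k using gidealD(1)[OF gM] .
  define D where "D = lie_bracket u"
  have uc: "u \<in> wspan d" using u graded_derived_subset_wspan by blast
  have Dc: "D a \<in> wspan (d + e)" if "a \<in> wspan e" for a e
    unfolding D_def using wspan_lie_bracket uc that by blast
  have D_mult: "D (a * b) = D a * b + a * D b" for a b
    unfolding D_def by (simp add: lie_bracket_def algebra_simps)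
  have D_u: "D (u * a) = u * D a" for a
    unfolding D_def by (simp add: lie_bracket_def algebra_simps)
  have D_add: "D (a + b) = D a + D b" for a b
    unfolding D_def by (rule lie_bracket_add_right)
  have DDcen: "central_mod M (d + (d + e)) (D (D a))" if "a \<in> wspan e" for a e
  proof -
    have "D a \<in> graded_derived i (d + e)" unfolding D_def by (rule graded_derived_lie_ideal[OF u that])
    then show ?thesis unfolding D_def using cen graded_derived_Suc_bracket u by blast
  qed
  have DD: "D (D a) \<in> M (d + (d + e))" if a: "a \<in> wspan e" for a e
  proof -
    let ?z = "D (D a)"
    have zc: "?z \<in> wspan (d + (d + e))" using Dc a by blast
    have "central_mod M (d + (d + (d + e))) (D (D (u * a)))"
      using DDcen wspan_mult uc a by blast
    then have "lie_bracket (u * ?z) b0 \<in> M (d + (d + (d + e)) + e0)"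
      using b0 unfolding central_mod_def D_u by blast
    moreover have "u * lie_bracket ?z b0 \<in> M (d + (d + (d + e) + e0))"
      using gidealD(2)[OF gM uc] DDcen[OF a] b0 unfolding central_mod_def by blast
    moreover have "lie_bracket ?z (D b0) \<in> M (d + (d + e) + (d + e0))"
      using DDcen[OF a] Dc[OF b0(1)] unfolding central_mod_def by blast
    \<comment> \<open>The three terms on the right lie in \<open>M\<close> because \<open>?z\<close>
      and \<open>u * ?z\<close> are central modulo \<open>M\<close>. As \<open>D b0\<close> is not
      in \<open>M\<close>, regularity of \<open>?z\<close> forces \<open>?z\<close> into
      \<open>M\<close>.\<close>
    moreover have "?z * D b0 = lie_bracket (u * ?z) b0 - u * lie_bracket ?z b0 + lie_bracket ?z (D b0)"
      unfolding D_def by (simp add: lie_bracket_def algebra_simps)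
    ultimately have "?z * D b0 \<in> M (d + (d + e) + (d + e0))"
      using subspace_add[OF sub] subspace_diff[OF sub] by (simp add: add_ac)
    then show ?thesis
      using central_mod_regular[OF M zc DDcen[OF a] Dc[OF b0(1)]] b0(2) unfolding D_def by blast
  qed
  have DaDb: "D a * D b \<in> M (d + e + (d + f))" if a: "a \<in> wspan e" and b: "b \<in> wspan f" for a b e f
  proof -
    have "D (D (a * b)) \<in> M (d + (d + (e + f)))" using DD wspan_mult a b by blast
    moreover have "D (D a) * b \<in> M (d + (d + e) + f)" using gidealD(3)[OF gM b DD[OF a]] .
    moreover have "a * D (D b) \<in> M (e + (d + (d + f)))" using gidealD(2)[OF gM a DD[OF b]] .
    moreover have "D a * D b + D a * D b = D (D (a * b)) - D (D a) * b - a * D (D b)"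
      by (simp add: D_mult D_add algebra_simps)
    ultimately have "D a * D b + D a * D b \<in> M (d + e + (d + f))"
      using subspace_diff[OF sub] by (simp add: add_ac)
    then show ?thesis using two_cancel_subspace two sub by blast
  qed
  have "D b0 \<in> M (d + e0) \<or> D b0 \<in> M (d + e0)"
  proof (rule maximal_nonfull_prime[OF M Dc[OF b0(1)] Dc[OF b0(1)]])
    fix c f assume c: "c \<in> wspan f"
    have "D (b0 * c) * D b0 \<in> M (d + (e0 + f) + (d + e0))" using DaDb wspan_mult b0 c by blast
    moreover have "b0 * (D c * D b0) \<in> M (e0 + (d + f + (d + e0)))"
      using gidealD(2)[OF gM b0(1) DaDb[OF c b0(1)]] .
    \<comment> \<open>The Leibniz rule for \<open>D (b0 * c)\<close> inserts the middle factor
      \<open>c\<close> that primeness asks for.\<close>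
    moreover have "D b0 * c * D b0 = D (b0 * c) * D b0 - b0 * (D c * D b0)"
      by (simp add: D_mult algebra_simps)
    ultimately show "D b0 * c * D b0 \<in> M (d + e0 + f + (d + e0))"
      using subspace_diff[OF sub] by (simp add: add_ac)
  qed
  then show False using b0 unfolding D_def by blast
qed

text \<open>Otherwise some maximal \<open>M\<close> contains \<open>P\<close>. Stage
  \<open>i\<close> is central modulo \<open>M\<close>, and centrality descends to stage 0.
  Generators are then central and nilpotent modulo a prime, hence in \<open>M 1\<close>, which makes
  \<open>M\<close> eventually full.\<close>

lemma gideal_containing_graded_derived_eventually_full:
  assumes two: "(2::'f) \<noteq> 0" and nil: "\<forall>a\<in>G. nilpotent_element a"
    and P: "gideal P" and sub: "\<And>d. graded_derived i d \<subseteq> P d"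
  shows "eventually_full P"
proof (rule ccontr)
  assume "\<not> eventually_full P"
  then obtain M where M: "maximal_nonfull M" and PM: "\<And>d. P d \<subseteq> M d"
    using ex_maximal_nonfull[OF P] by blast
  have gM: "gideal M" and nc: "\<not> eventually_full M"
    using M unfolding maximal_nonfull_def by blast+
  have "\<forall>d. \<forall>x\<in>graded_derived i d. central_mod M d x"
  proof (intro allI ballI)
    fix d x assume "x \<in> graded_derived i d"
    then show "central_mod M d x"
      unfolding central_mod_def using graded_derived_lie_ideal sub PM by blast
  qed
  moreover have "\<forall>d. \<forall>x\<in>graded_derived j d. central_mod M d x"
    if "\<forall>d. \<forall>x\<in>graded_derived (Suc j) d. central_mod M d x" for j
    using lie_ideal_central_step[OF two M] that by blast
  ultimately have "\<forall>d. \<forall>x\<in>graded_derived 0 d. central_mod M d x"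
    by (induction i) blast+
  then have cen: "\<And>d x. x \<in> wspan d \<Longrightarrow> central_mod M d x" by simp
  have "g \<in> M 1" if g: "g \<in> G" for g
  proof -
    have gc: "g \<in> wspan 1" using g words_wspan[of g 1] by simp
    have pc: "((*) g ^^ m) g \<in> wspan (Suc m)" for m
    proof (induction m)
      case (Suc m)
      then show ?case using wspan_mult[OF gc Suc] by simp
    qed (use gc in simp)
    \<comment> \<open>The iterate is the power of \<open>g\<close> with exponent
      \<open>m + 1\<close>; regularity of the central element \<open>g\<close> strips off one factor
      at a time.\<close>
    have *: "((*) g ^^ m) g \<in> M (Suc m) \<Longrightarrow> g \<in> M 1" for m
    proof (induction m)
      case (Suc m)
      then show ?case
        using central_mod_regular[OF M gc cen[OF gc] pc[of m]] by auto
    qed simp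
    obtain n where "((*) g ^^ (n - 1)) g = 0"
      using nil g unfolding nilpotent_element_def ring_power_def by blast
    then show ?thesis using *[of "n - 1"] subspace_0[OF gidealD(1)[OF gM]] by simp
  qed
  then have "wspan 1 \<subseteq> M 1"
    unfolding wspan_def by (intro span_minimal gidealD(1)[OF gM]) auto
  then show False using nc unfolding eventually_full_def by (metis zero_less_one)
qed

subsection \<open>Brackets with long words\<close>

text \<open>Herstein's \<open>T(U) = {x. [x, A] \<subseteq> U}\<close> for the Lie ideal
  \<open>U\<close> given by stage \<open>i\<close>, in length \<open>d\<close>.\<close>

definition bracket_core :: "nat \<Rightarrow> nat \<Rightarrow> 'a set" where
  "bracket_core i d = {x \<in> wspan d. \<forall>e. \<forall>y\<in>wspan e. lie_bracket x y \<in> graded_derived i (d + e)}"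

lemma subspace_bracket_core [simp, intro]: "subspace (bracket_core i d)"
  using subspace_graded_derived[of i] subspace_wspan[of d] unfolding bracket_core_def
  by (simp add: subspace_def lie_bracket_add_left lie_bracket_scale_left)

lemma graded_derived_bracket_core: "x \<in> graded_derived i d \<Longrightarrow> x \<in> bracket_core i d"
  using graded_derived_lie_ideal graded_derived_subset_wspan unfolding bracket_core_def by blast

text \<open>\<open>[x * y, a] = [x, y * a] + [y, a * x]\<close>, so \<open>T(U)\<close> is closed
  under products.\<close>

lemma bracket_core_mult:
  assumes x: "x \<in> bracket_core i d" and y: "y \<in> bracket_core i e"
  shows "x * y \<in> bracket_core i (d + e)"
  unfolding bracket_core_def
proof (intro CollectI conjI allI ballI)
  have xc: "x \<in> wspan d" and yc: "y \<in> wspan e" using x y unfolding bracket_core_def by blast+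
  then show "x * y \<in> wspan (d + e)" by (rule wspan_mult)
  fix f a assume a: "a \<in> wspan f"
  have "lie_bracket x (y * a) \<in> graded_derived i (d + (e + f))" "lie_bracket y (a * x) \<in> graded_derived i (e + (f + d))"
    using x y wspan_mult xc yc a unfolding bracket_core_def by blast+
  moreover have "lie_bracket (x * y) a = lie_bracket x (y * a) + lie_bracket y (a * x)"
    by (simp add: lie_bracket_def algebra_simps)
  ultimately show "lie_bracket (x * y) a \<in> graded_derived i (d + e + f)"
    using subspace_add[OF subspace_graded_derived] by (simp add: add_ac)
qed

text \<open>In \<open>[u, v] * a = [u, v * a] - v * [u, a]\<close> the first term lies in
  \<open>U\<close> and the second is a product of two elements of \<open>U\<close>; both are in
  \<open>T(U)\<close>.\<close>

lemma graded_derived_Suc_mult_bracket_core: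
  assumes x: "x \<in> graded_derived (Suc i) d" and a: "a \<in> wspan e"
  shows "x * a \<in> bracket_core i (d + e)"
  using x
proof (rule graded_derived_induct)
  show "subspace {x. x * a \<in> bracket_core i (d + e)}"
    by (rule subspace_mult_left) (rule subspace_bracket_core)
  fix u v d1 d2 assume d: "d = d1 + d2" and u: "u \<in> graded_derived i d1" and v: "v \<in> graded_derived i d2"
  have vc: "v \<in> wspan d2" using v graded_derived_subset_wspan by blast
  have "lie_bracket u (v * a) \<in> bracket_core i (d1 + (d2 + e))"
    using graded_derived_bracket_core graded_derived_lie_ideal u wspan_mult vc a by blast
  moreover have "v * lie_bracket u a \<in> bracket_core i (d2 + (d1 + e))"
    using bracket_core_mult graded_derived_bracket_core graded_derived_lie_ideal u v a by blast
  moreover have "lie_bracket u v * a = lie_bracket u (v * a) - v * lie_bracket u a"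
    by (simp add: lie_bracket_def algebra_simps)
  ultimately show "lie_bracket u v * a \<in> bracket_core i (d + e)"
    unfolding d using subspace_diff[OF subspace_bracket_core] by (simp add: add_ac)
qed

text \<open>The largest graded ideal inside \<open>T(U)\<close> serves: it contains
  \<open>[U, U]\<close> because all one-sided and two-sided multiples of \<open>[U, U]\<close> lie
  in \<open>T(U)\<close>.\<close>

lemma ex_gideal_in_bracket_core:
  obtains I where "gideal I" "\<And>d. graded_derived (Suc i) d \<subseteq> I d" "\<And>d. I d \<subseteq> bracket_core i d"
proof
  define T where "T = bracket_core i"
  \<comment> \<open>Without a unit, the one-sided multiples and \<open>x\<close> itself are not
    instances of \<open>a * x * b\<close>, so each needs its own condition.\<close>
  define I where "I d = {x \<in> T d. (\<forall>e. \<forall>a\<in>wspan e. a * x \<in> T (d + e) \<and> x * a \<in> T (d + e)) \<and>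
    (\<forall>e f. \<forall>a\<in>wspan e. \<forall>b\<in>wspan f. a * x * b \<in> T (d + e + f))}" for d
  have sub: "subspace (T d)" for d unfolding T_def by simp
  show "gideal I"
  proof (rule gidealI)
    show "subspace (I d)" for d
      using sub unfolding I_def
      by (simp add: subspace_def distrib_left distrib_right scale_mult_left scale_mult_right)
    fix d e x y assume x: "x \<in> wspan d" and y: "y \<in> I e"
    have y1: "\<And>f a. a \<in> wspan f \<Longrightarrow> a * y \<in> T (e + f) \<and> y * a \<in> T (e + f)"
      and y2: "\<And>f g a b. a \<in> wspan f \<Longrightarrow> b \<in> wspan g \<Longrightarrow> a * y * b \<in> T (e + f + g)"
      using y unfolding I_def by blast+
    show "x * y \<in> I (d + e)"
      unfolding I_def
    proof (intro CollectI conjI allI ballI)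
      show "x * y \<in> T (d + e)" using y1[OF x] by (simp add: add_ac)
      fix f a assume a: "a \<in> wspan f"
      show "a * (x * y) \<in> T (d + e + f)"
        using y1[OF wspan_mult[OF a x]] by (simp add: add_ac mult.assoc)
      show "x * y * a \<in> T (d + e + f)"
        using y2[OF x a] by (simp add: add_ac)
      fix g b assume b: "b \<in> wspan g"
      show "a * (x * y) * b \<in> T (d + e + f + g)"
        using y2[OF wspan_mult[OF a x] b] by (simp add: add_ac mult.assoc)
    qed
    show "y * x \<in> I (e + d)"
      unfolding I_def
    proof (intro CollectI conjI allI ballI)
      show "y * x \<in> T (e + d)" using y1[OF x] by (simp add: add_ac)
      fix f a assume a: "a \<in> wspan f"
      show "y * x * a \<in> T (e + d + f)"
        using y1[OF wspan_mult[OF x a]] by (simp add: add_ac mult.assoc)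
      show "a * (y * x) \<in> T (e + d + f)"
        using y2[OF a x] by (simp add: add_ac mult.assoc)
      fix g b assume b: "b \<in> wspan g"
      show "a * (y * x) * b \<in> T (e + d + f + g)"
        using y2[OF a wspan_mult[OF x b]] by (simp add: add_ac mult.assoc)
    qed
  qed
  show "I d \<subseteq> bracket_core i d" for d unfolding I_def T_def by blast
  show "graded_derived (Suc i) d \<subseteq> I d" for d
  proof
    fix x assume x: "x \<in> graded_derived (Suc i) d"
    have U: "z \<in> T k" if "z \<in> graded_derived (Suc i) k" for z k
      unfolding T_def using that graded_derived_Suc_subset graded_derived_bracket_core by blast
    have R: "z * a \<in> T (k + e)" if "z \<in> graded_derived (Suc i) k" "a \<in> wspan e" for z k a e
      unfolding T_def using graded_derived_Suc_mult_bracket_core that by blast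
    \<comment> \<open>A left multiple differs from a right multiple by a bracket that stays in
      \<open>[U, U]\<close>, so everything reduces to right multiplication.\<close>
    have comm: "a * x = x * a - lie_bracket x a" for a by (simp add: lie_bracket_def)
    have xa: "lie_bracket x a \<in> graded_derived (Suc i) (d + e)" if "a \<in> wspan e" for a e
      using graded_derived_lie_ideal x that by blast
    show "x \<in> I d"
      unfolding I_def
    proof (intro CollectI conjI allI ballI)
      show "x \<in> T d" using U x by blast
      fix e a assume a: "a \<in> wspan e"
      show "x * a \<in> T (d + e)" using R x a by blast
      show "a * x \<in> T (d + e)"
        unfolding comm using R[OF x a] U[OF xa[OF a]] subspace_diff[OF sub] by blast
      fix f b assume b: "b \<in> wspan f"
      have "x * (a * b) \<in> T (d + (e + f))" "lie_bracket x a * b \<in> T (d + e + f)"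
        using R x a b wspan_mult xa by blast+
      then show "a * x * b \<in> T (d + e + f)"
        unfolding comm left_diff_distrib using subspace_diff[OF sub] by (simp add: mult.assoc add.assoc)
    qed
  qed
qed

text \<open>The identity \<open>[x, y * g] = [x * y, g] + [g * x, y]\<close> moves letters
  cyclically and shortens the right entry to a single letter, with the total length
  unchanged.\<close>

lemma graded_derived_1_subset_span:
  "graded_derived (Suc 0) (Suc d) \<subseteq> span {lie_bracket x g | x g. x \<in> wspan d \<and> g \<in> G}" (is "_ \<subseteq> ?V d")
proof -
  have *: "lie_bracket x y \<in> ?V d" if "x \<in> wspan e" "y \<in> words f" "e + f = Suc d" for x y e f
    using that
  proof (induction f arbitrary: x y e rule: words.induct)
    case 2
    then show ?case by (auto intro!: span_base)
  next
    case (3 n)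
    then obtain y' g where y: "y = y' * g" "y' \<in> words (Suc n)" "g \<in> G" by auto
    have g: "g \<in> wspan 1" using y words_wspan[of g 1] by simp
    have "lie_bracket (g * x) y' \<in> ?V d"
      using 3 y wspan_mult[OF g 3(2)] by (intro 3(1)[of _ "1 + e"]) auto
    moreover have "x * y' \<in> wspan d"
      using wspan_mult[OF 3(2) words_wspan[OF y(2)]] 3(4) by simp
    then have "lie_bracket (x * y') g \<in> ?V d"
      using y(3) by (intro span_base) blast
    moreover have "lie_bracket x y = lie_bracket (x * y') g + lie_bracket (g * x) y'"
      by (simp add: lie_bracket_def algebra_simps y)
    ultimately show ?case using span_add by simp
  qed auto
  show ?thesis
  proof
    fix x assume "x \<in> graded_derived (Suc 0) (Suc d)"
    then show "x \<in> ?V d"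
    proof (rule graded_derived_induct)
      fix u v e f assume "Suc d = e + f" "u \<in> graded_derived 0 e" "v \<in> graded_derived 0 f"
      moreover from this have "v \<in> span (words f)" by (simp add: wspan_def)
      then have "lie_bracket u v \<in> ?V d"
        by (rule span_induct_subspace[OF _ subspace_bracket_right])
          (use * calculation in auto)
      then show "lie_bracket u v \<in> ?V d" .
    qed simp
  qed
qed

text \<open>The ideal inside \<open>T(U)\<close> is eventually full, so every long \<open>x\<close>
  has \<open>[x, g]\<close> in stage \<open>i\<close>, and such brackets span stage 1.\<close>

lemma graded_derived_1_eventually_subset:
  assumes "(2::'f) \<noteq> 0" and "\<forall>a\<in>G. nilpotent_element a"
  obtains N where "\<And>d. d \<ge> N \<Longrightarrow> graded_derived (Suc 0) d \<subseteq> graded_derived i d"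
proof -
  obtain I where I: "gideal I" "\<And>d. graded_derived (Suc i) d \<subseteq> I d" "\<And>d. I d \<subseteq> bracket_core i d"
    using ex_gideal_in_bracket_core by blast
  then have "eventually_full I" using gideal_containing_graded_derived_eventually_full assms by blast
  then obtain n where n: "n > 0" "wspan n \<subseteq> I n" unfolding eventually_full_def by blast
  \<comment> \<open>One letter of the total length goes to \<open>g\<close>; the other entry keeps
    length at least \<open>n\<close>.\<close>
  have "graded_derived (Suc 0) d \<subseteq> graded_derived i d" if "d \<ge> Suc n" for d
  proof -
    obtain d' where d': "d = Suc d'" "n \<le> d'" using \<open>d \<ge> Suc n\<close> by (cases d) auto
    have core: "wspan d' \<subseteq> bracket_core i d'"
      using wspan_subset_gideal_mono[OF I(1) n d'(2)] I(3) by blast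
    have "lie_bracket x g \<in> graded_derived i d" if "x \<in> wspan d'" "g \<in> G" for x g
    proof -
      have "g \<in> wspan 1" using that words_wspan[of g 1] by simp
      then have "lie_bracket x g \<in> graded_derived i (d' + 1)"
        using core that unfolding bracket_core_def by blast
      then show ?thesis using d' by simp
    qed
    then have "span {lie_bracket x g | x g. x \<in> wspan d' \<and> g \<in> G} \<subseteq> graded_derived i d"
      by (intro span_minimal) auto
    then show ?thesis using graded_derived_1_subset_span d' by blast
  qed
  then show thesis using that by blast
qed

subsection \<open>Finite generation of the derived powers\<close>

lemma words_cover:
  assumes "x \<in> G" "set xs \<subseteq> G"
  shows "\<exists>d. foldl (*) x xs \<in> words d"
  using assms(2)
proof (induction xs rule: rev_induct)
  case Nil
  have "foldl (*) x [] \<in> words 1" using assms by simp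
  then show ?case by blast
next
  case (snoc y ys)
  then obtain d where "foldl (*) x ys \<in> words d" by auto
  then have "foldl (*) x (ys @ [y]) \<in> words (Suc d)" using snoc words_Suc by simp
  then show ?case by blast
qed

text \<open>Bilinearity of the bracket carries the equality from stage to stage; stage 0 is the
  assumption that \<open>G\<close> generates.\<close>

lemma derived_power_eq_span_graded_derived:
  assumes "algebra_generated_by G"
  shows "derived_power i = span (\<Union>d. graded_derived i d)"
proof (induction i)
  case 0
  have "nonempty_products G \<subseteq> (\<Union>d. graded_derived 0 d)"
    using words_cover words_wspan unfolding nonempty_products_def by fastforce
  then have "span (nonempty_products G) \<subseteq> span (\<Union>d. graded_derived 0 d)" by (rule span_mono)
  then show ?case using assms unfolding algebra_generated_by_def by auto
next
  case (Suc i)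
  show ?case
  proof
    show "derived_power (Suc i) \<subseteq> span (\<Union>d. graded_derived (Suc i) d)"
      unfolding derived_power.simps bracket_space_def
    proof (rule span_minimal)
      show "{lie_bracket x y | x y. x \<in> derived_power i \<and> y \<in> derived_power i}
          \<subseteq> span (\<Union>d. graded_derived (Suc i) d)"
      proof clarify
        fix x y assume "x \<in> derived_power i" "y \<in> derived_power i"
        then show "lie_bracket x y \<in> span (\<Union>d. graded_derived (Suc i) d)"
          unfolding Suc
          by (rule bracket_span_mem) (blast intro: span_base graded_derived_Suc_bracket subspace_span)+
      qed
    qed simp
    have "graded_derived (Suc i) d \<subseteq> derived_power (Suc i)" for d
    proof
      fix x assume "x \<in> graded_derived (Suc i) d"
      then show "x \<in> derived_power (Suc i)"
      proof (rule graded_derived_induct)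
        show "subspace {x. x \<in> derived_power (Suc i)}" by (simp add: bracket_space_def)
        fix u v e f assume "u \<in> graded_derived i e" "v \<in> graded_derived i f"
        then have "u \<in> derived_power i" "v \<in> derived_power i"
          unfolding Suc by (auto intro!: span_base)
        then show "lie_bracket u v \<in> derived_power (Suc i)"
          by (auto simp: bracket_space_def intro!: span_base)
      qed
    qed
    then show "span (\<Union>d. graded_derived (Suc i) d) \<subseteq> derived_power (Suc i)"
      by (intro span_minimal) (auto simp: bracket_space_def)
  qed
qed

text \<open>Components of length below \<open>N\<close> supply finitely many generators. From
  \<open>N\<close> on, stage \<open>Suc i\<close> lies in stage 1, hence in stage
  \<open>Suc (Suc i)\<close>, so it is spanned by brackets of its own shorter components.\<close>

lemma derived_power_finitely_generated:
  assumes two: "(2::'f) \<noteq> 0" and nil: "\<forall>a\<in>G. nilpotent_element a"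
    and gen: "algebra_generated_by G"
  shows "finitely_generated_lie (derived_power (Suc i))"
proof -
  obtain N where N: "\<And>d. d \<ge> N \<Longrightarrow> graded_derived (Suc 0) d \<subseteq> graded_derived (Suc (Suc i)) d"
    using graded_derived_1_eventually_subset[OF two nil] by blast
  have "\<exists>E. finite E \<and> E \<subseteq> graded_derived (Suc i) d \<and> graded_derived (Suc i) d \<subseteq> span E" for d
    using subspace_finite_generating_set[OF finite_words subspace_graded_derived] graded_derived_subset_wspan wspan_def
    by metis
  then obtain E where E: "\<And>d. finite (E d)" "\<And>d. E d \<subseteq> graded_derived (Suc i) d"
      "\<And>d. graded_derived (Suc i) d \<subseteq> span (E d)"
    by metis
  define S where "S = (\<Union>d<N. E d)"
  have eq: "derived_power (Suc i) = span (\<Union>d. graded_derived (Suc i) d)"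
    using derived_power_eq_span_graded_derived[OF gen] .
  have SL: "S \<subseteq> derived_power (Suc i)"
    unfolding eq S_def using E(2) span_base by blast
  \<comment> \<open>Stated for an arbitrary intermediate subalgebra, to be applied to the Lie hull
    of \<open>S\<close>.\<close>
  have L: "L = derived_power (Suc i)"
    if LS: "S \<subseteq> L" and LL: "lie_subalgebra L" and LD: "L \<subseteq> derived_power (Suc i)" for L
  proof -
    have subL: "subspace L" and brL: "\<And>x y. x \<in> L \<Longrightarrow> y \<in> L \<Longrightarrow> lie_bracket x y \<in> L"
      using LL unfolding lie_subalgebra_def by blast+
    have "graded_derived (Suc i) d \<subseteq> L" for d
    proof (induction d rule: less_induct)
      case (less d)
      show ?case
      proof (cases "d < N")
        case True
        then have "E d \<subseteq> L" using LS unfolding S_def by blast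
        then show ?thesis using E(3) span_minimal[OF _ subL] by blast
      next
        case False
        then have "graded_derived (Suc i) d \<subseteq> graded_derived (Suc (Suc i)) d"
          using N[of d] graded_derived_Suc_subset_1[of i d] by auto
        moreover have "graded_derived (Suc (Suc i)) d \<subseteq> L"
        proof
          fix x assume "x \<in> graded_derived (Suc (Suc i)) d"
          then show "x \<in> L"
          proof (rule graded_derived_induct)
            show "subspace {x. x \<in> L}" using subL by simp
            fix u v e f assume d: "d = e + f" and u: "u \<in> graded_derived (Suc i) e" and v: "v \<in> graded_derived (Suc i) f"
            show "lie_bracket u v \<in> L"
            \<comment> \<open>A length 0 entry would leave the other length equal to
              \<open>d\<close>, out of reach of the induction; but such an entry is zero.\<close>
            proof (cases "e = 0 \<or> f = 0")
              case True
              then have "u = 0 \<or> v = 0" using u v graded_derived_subset_wspan wspan_0 by blast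
              then show ?thesis using subspace_0[OF subL] by auto
            next
              case False
              then show ?thesis using less d u v brL
                by (metis less_add_same_cancel1 less_add_same_cancel2 not_gr_zero subsetD)
            qed
          qed
        qed
        ultimately show ?thesis by blast
      qed
    qed
    then have "derived_power (Suc i) \<subseteq> L"
      unfolding eq by (intro span_minimal subL) blast
    then show ?thesis using LD by blast
  qed
  have "lie_subalgebra (lie_subalgebra hull S)"
    unfolding hull_def lie_subalgebra_def subspace_def by blast
  then have "lie_subalgebra hull S = derived_power (Suc i)"
    by (intro L hull_subset hull_minimal SL lie_subalgebra_derived_power)
  moreover have "finite S" unfolding S_def using E(1) by blast
  ultimately show ?thesis
    unfolding finitely_generated_lie_def using SL lie_subalgebra_derived_power by blast
qed

end

theorem theorem1:
  fixes scale :: "'f::field \<Rightarrow> 'a::ring \<Rightarrow> 'a"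
    and G :: "'a set" and i :: nat
  assumes "assoc_algebra scale"
    and "CHAR('f) \<noteq> 2"
    and "finite G"
    and "\<forall>a\<in>G. nilpotent_element a"
    and "assoc_algebra.algebra_generated_by scale G"
    and "i \<ge> 1"
  shows "assoc_algebra.finitely_generated_lie scale (assoc_algebra.derived_power scale i)"
proof -
  interpret fg_algebra scale G
    using assms(1,3) by (simp add: fg_algebra_def fg_algebra_axioms_def)
  have "(2::'f) \<noteq> 0"
  proof
    assume "(2::'f) = 0"
    then have "of_nat 2 = (0::'f)" by simp
    \<comment> \<open>The divisors of 2 are 1 and 2, and a field cannot have characteristic
      1.\<close>
    then have "CHAR('f) dvd 2" by (simp only: of_nat_eq_0_iff_char_dvd)
    then have "CHAR('f) \<le> 2" "CHAR('f) \<noteq> 0"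
      using dvd_imp_le[of "CHAR('f)" 2] dvd_0_left_iff[of "2::nat"] by (simp, metis zero_neq_numeral)
    then show False using assms(2) CHAR_not_1[where 'a = 'f] by linarith
  qed
  moreover obtain j where "i = Suc j" using assms(6) by (cases i) auto
  ultimately show ?thesis
    using derived_power_finitely_generated assms(4,5) by blast
qed

end
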